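(* Let $K\subset\mathbb{R}^n$ be a polyhedral cone with normalized conic base $B_K=\{u^1,\ldots,u^p\}$ ($p\ge1$), so that $K=\operatorname{cone}(B_K)$, and suppose $B_K$ is linearly independent. Let $d:=-P_{\operatorname{aff}(B_K)}(0)$ be the circumcentric direction, let $M\in\mathbb{R}^{p\times p}$, $M_{ij}=\langle u^i,u^j\rangle$, be the Gram matrix of $B_K$, and let $\mathbf{1}\in\mathbb{R}^p$ be the all-ones vector. Then $$d=-\frac{1}{\mathbf{1}^\top M^{-1}\mathbf{1}}\sum_{i=1}^{p}(M^{-1}\mathbf{1})_i\,u^i,\qquad \|d\|^2=\frac{1}{\mathbf{1}^\top M^{-1}\mathbf{1}},$$ and $$\frac{\lambda_{\min}(M)}{p}\le\|d\|^2\le\frac{\lambda_{\max}(M)}{p}\le 1.$$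
   Context: $\langle\cdot,\cdot\rangle$ and $\|\cdot\|$ are the Euclidean inner product and norm. The normalized conic base $B_K=\{u^1,\ldots,u^p\}$ of a polyhedral cone $K$ is the finite set of unit vectors along the extreme rays of $K$. $\operatorname{aff}(B_K)$ is the affine hull and $P_{\operatorname{aff}(B_K)}(0)$ is the orthogonal projection of the origin onto it (this is the circumcenter of $B_K$). $\lambda_{\min}(M)$ and $\lambda_{\max}(M)$ denote the smallest and largest eigenvalues of the symmetric matrix $M$. *)

theory Defs
  imports "HOL-Analysis.Analysis"
begin

text \<open>A unit vector \<open>u\<close> spans an extreme ray of \<open>K\<close> iff the ray \<open>conic hull {u} = {t u | t \<ge> 0}\<close>
  is a face of \<open>K\<close>.  A cone containing a line has no extreme rays in this sense.\<close>

definition normalized_conic_base :: "'a::euclidean_space set \<Rightarrow> 'a set"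
  where "normalized_conic_base K = {u. norm u = 1 \<and> (conic hull {u}) face_of K}"

definition circumcentric_direction :: "'a::euclidean_space set \<Rightarrow> 'a"
  where "circumcentric_direction K = - closest_point (affine hull (normalized_conic_base K)) 0"

definition gram_matrix :: "('p \<Rightarrow> 'a::real_inner) \<Rightarrow> real^'p^'p"
  where "gram_matrix u = (\<chi> i j. u i \<bullet> u j)"

definition eigenvalues :: "real^'p^'p \<Rightarrow> real set"
  where "eigenvalues A = {k. \<exists>v. v \<noteq> 0 \<and> A *v v = k *\<^sub>R v}"

text \<open>Meant for symmetric matrices, whose set of real eigenvalues is finite and nonempty.\<close>

definition lambda_min :: "real^'p^'p \<Rightarrow> real"
  where "lambda_min A = Min (eigenvalues A)"

definition lambda_max :: "real^'p^'p \<Rightarrow> real"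
  where "lambda_max A = Max (eigenvalues A)"

end

theory Submission
  imports Defs
begin

text \<open>Write \<open>G c = (\<Sum>i. c i u i)\<close>, so that \<open>M c = (u i \<bullet> G c)\<^sub>i\<close> and \<open>c \<bullet> M c = |G c|\<^sup>2\<close>. Let
  \<open>M w = 1\<close> and \<open>s = 1 \<bullet> w\<close>. The point \<open>G (w / s)\<close> lies in the affine hull of the \<open>u i\<close> and has the
  same inner product \<open>1 / s\<close> with each of them, hence with every point of the hull; it is therefore
  the projection of the origin, and its squared norm is \<open>1 / s\<close>. The lower eigenvalue bound is the
  Rayleigh bound at \<open>w / s\<close> together with Cauchy--Schwarz; the upper one compares the projection
  with the barycentre \<open>G (1 / p)\<close> of the base.\<close>

section \<open>Rayleigh quotients of symmetric matrices\<close>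

lemma inner_symmetric_matrix:
  fixes A :: "real^'p^'p"
  assumes "transpose A = A"
  shows "(A *v x) \<bullet> y = x \<bullet> (A *v y)"
  by (metis assms dot_lmul_matrix vector_transpose_matrix)

text \<open>A zero of a nonnegative form is a minimum. If \<open>z = B *v v\<close> were nonzero, a
  small step from \<open>v\<close> along \<open>- z\<close> would make the form negative, since the
  linear term \<open>- 2 * t * (z \<bullet> z)\<close> outweighs the quadratic one.\<close>

lemma psd_form_zero_imp_kernel:
  fixes B :: "real^'p^'p"
  assumes sym: "transpose B = B" and psd: "\<And>v. 0 \<le> v \<bullet> (B *v v)" and zero: "v \<bullet> (B *v v) = 0"
  shows "B *v v = 0"
proof (rule ccontr)
  define z where "z = B *v v"
  define q where "q = z \<bullet> (B *v z)"
  assume "B *v v \<noteq> 0"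
  then have z: "z \<bullet> z > 0" by (simp add: z_def)
  have q: "0 \<le> q" using psd by (simp add: q_def)
  have vz: "v \<bullet> (B *v z) = z \<bullet> z"
    using inner_symmetric_matrix[OF sym] by (metis z_def)
  have expand: "(v - t *\<^sub>R z) \<bullet> (B *v (v - t *\<^sub>R z)) = t * (t * q - 2 * (z \<bullet> z))" for t
    using zero vz
    by (simp add: matrix_vector_mult_diff_distrib matrix_vector_mult_scaleR inner_diff_left
        inner_diff_right z_def[symmetric] q_def[symmetric] algebra_simps)
  \<comment> \<open>The \<open>+ 1\<close> avoids division by zero when \<open>q = 0\<close>; this
    \<open>t\<close> still gives \<open>t * q \<le> z \<bullet> z\<close>, so the second factor of
    \<open>expand\<close> is at most \<open>- (z \<bullet> z)\<close>.\<close>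
  define t where "t = (z \<bullet> z) / (q + 1)"
  have t: "t > 0" using z q by (simp add: t_def)
  have "t * q \<le> z \<bullet> z" using z q by (simp add: t_def field_simps)
  then have "t * (t * q - 2 * (z \<bullet> z)) < 0"
    using t z by (intro mult_pos_neg; linarith)
  then show False using psd[of "v - t *\<^sub>R z"] expand[of t] by simp
qed

text \<open>Eigenvectors for distinct eigenvalues are orthogonal, hence independent, and the
  dimension bounds their number. Finiteness is what gives \<open>Min\<close> and \<open>Max\<close>
  their meaning in \<open>lambda_min\<close> and \<open>lambda_max\<close>.\<close>

lemma finite_eigenvalues:
  fixes A :: "real^'p^'p"
  assumes sym: "transpose A = A"
  shows "finite (eigenvalues A)"
proof -
  have "\<forall>k\<in>eigenvalues A. \<exists>v. v \<noteq> 0 \<and> A *v v = k *\<^sub>R v"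
    by (simp add: eigenvalues_def)
  then obtain v where v: "\<And>k. k \<in> eigenvalues A \<Longrightarrow> v k \<noteq> 0 \<and> A *v v k = k *\<^sub>R v k"
    by metis
  have orth: "v k \<bullet> v l = 0" if "k \<in> eigenvalues A" "l \<in> eigenvalues A" "k \<noteq> l" for k l
    using inner_symmetric_matrix[OF sym, of "v k" "v l"] v[OF that(1)] v[OF that(2)] that(3) by simp
  \<comment> \<open>A vector chosen for two eigenvalues would be orthogonal to itself, hence
    zero.\<close>
  have inj: "inj_on v (eigenvalues A)"
    by (rule inj_onI) (metis orth v inner_eq_zero_iff)
  have "pairwise orthogonal (v ` eigenvalues A)"
    using orth by (auto simp: pairwise_def orthogonal_def)
  moreover have "0 \<notin> v ` eigenvalues A" using v by auto
  ultimately have "independent (v ` eigenvalues A)"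
    by (rule pairwise_orthogonal_independent)
  then show ?thesis
    using independent_bound inj finite_imageD by blast
qed

text \<open>The form attains a maximum \<open>m\<close> on the compact unit sphere. The maximiser is
  a zero of the nonnegative form of \<open>mat m - A\<close>, so it lies in the kernel and is an
  eigenvector.\<close>

lemma exists_maximal_eigenvalue:
  fixes A :: "real^'p^'p"
  assumes sym: "transpose A = A"
  shows "\<exists>m\<in>eigenvalues A. \<forall>v. v \<bullet> (A *v v) \<le> m * (v \<bullet> v)"
proof -
  have "compact (sphere (0::real^'p) 1)" "sphere (0::real^'p) 1 \<noteq> {}" by simp_all
  moreover have "continuous_on (sphere 0 1) (\<lambda>v. v \<bullet> (A *v v))"
    by (intro continuous_intros matrix_vector_mult_linear_continuous_on)
  ultimately obtain x where x: "norm x = 1"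
      and max: "\<And>y. norm y = 1 \<Longrightarrow> y \<bullet> (A *v y) \<le> x \<bullet> (A *v x)"
    using continuous_attains_sup[of "sphere 0 1" "\<lambda>v. v \<bullet> (A *v v)"] by auto
  define m where "m = x \<bullet> (A *v x)"
  have bound: "v \<bullet> (A *v v) \<le> m * (v \<bullet> v)" for v
  proof (cases "v = 0")
    case False
    then have "norm (v /\<^sub>R norm v) = 1" by simp
    from max[OF this] have "(v \<bullet> (A *v v)) / (norm v * norm v) \<le> m"
      by (simp add: m_def matrix_vector_mult_scaleR field_simps)
    then show ?thesis using False
      by (simp add: field_simps flip: power2_norm_eq_inner power2_eq_square)
  qed simp
  define B where "B = mat m - A"
  have mat: "mat m *v v = m *\<^sub>R v" for v :: "real^'p"
    by (simp add: vec_eq_iff matrix_vector_mult_def mat_def if_distrib[where f="\<lambda>x. x * _"] cong: if_cong)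
  have Bv: "B *v v = m *\<^sub>R v - A *v v" for v
    by (simp add: B_def matrix_vector_mult_diff_rdistrib mat)
  have "transpose B = B"
    using sym by (auto simp: B_def transpose_def mat_def vec_eq_iff)
  moreover have "0 \<le> v \<bullet> (B *v v)" for v
    using bound by (simp add: Bv inner_diff_right)
  moreover have "x \<bullet> (B *v x) = 0"
    using x by (simp add: Bv inner_diff_right m_def norm_eq_1)
  ultimately have "B *v x = 0" by (rule psd_form_zero_imp_kernel)
  then have "m \<in> eigenvalues A"
    using x unfolding eigenvalues_def by (auto simp: Bv intro!: exI[of _ x])
  with bound show ?thesis by blast
qed

lemma eigenvalues_uminus: "eigenvalues (- A) = uminus ` eigenvalues A"
proof -
  have "(- A) *v v = - (A *v v)" for v
    by (simp add: vec_eq_iff matrix_vector_mult_def sum_negf)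
  then show ?thesis
    by (auto simp: eigenvalues_def image_iff minus_equation_iff[of _ "_ *\<^sub>R _"] simp flip: scaleR_minus_left)
      (metis minus_minus)
qed

context
  fixes A :: "real^'p^'p"
  assumes sym: "transpose A = A"
begin

lemma eigenvalues_nonempty: "eigenvalues A \<noteq> {}"
  using exists_maximal_eigenvalue[OF sym] by blast

lemma lambda_max_in_eigenvalues: "lambda_max A \<in> eigenvalues A"
  unfolding lambda_max_def by (rule Max_in[OF finite_eigenvalues[OF sym] eigenvalues_nonempty])

lemma lambda_min_in_eigenvalues: "lambda_min A \<in> eigenvalues A"
  unfolding lambda_min_def by (rule Min_in[OF finite_eigenvalues[OF sym] eigenvalues_nonempty])

lemma rayleigh_le_lambda_max: "v \<bullet> (A *v v) \<le> lambda_max A * (v \<bullet> v)"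
proof -
  obtain m where m: "m \<in> eigenvalues A" "v \<bullet> (A *v v) \<le> m * (v \<bullet> v)"
    using exists_maximal_eigenvalue[OF sym] by blast
  have "m \<le> lambda_max A"
    unfolding lambda_max_def by (rule Max_ge[OF finite_eigenvalues[OF sym] m(1)])
  then show ?thesis
    using m(2) mult_right_mono[of m "lambda_max A" "v \<bullet> v"] by simp
qed

lemma lambda_min_le_rayleigh: "lambda_min A * (v \<bullet> v) \<le> v \<bullet> (A *v v)"
proof -
  \<comment> \<open>Negation turns the bound by a maximal eigenvalue of \<open>- A\<close> into a
    lower bound for the form of \<open>A\<close>.\<close>
  have "transpose (- A) = - A"
    using sym by (simp add: transpose_def vec_eq_iff)
  then obtain m where m: "m \<in> eigenvalues (- A)" "v \<bullet> ((- A) *v v) \<le> m * (v \<bullet> v)"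
    using exists_maximal_eigenvalue by blast
  have neg: "(- A) *v v = - (A *v v)"
    by (simp add: vec_eq_iff matrix_vector_mult_def sum_negf)
  have "- m \<in> eigenvalues A" using m(1) by (auto simp: eigenvalues_uminus)
  then have "lambda_min A \<le> - m"
    unfolding lambda_min_def by (rule Min_le[OF finite_eigenvalues[OF sym]])
  then show ?thesis
    using m(2) neg mult_right_mono[of "lambda_min A" "- m" "v \<bullet> v"] by simp
qed

end

section \<open>Gram matrices\<close>

lemma transpose_gram_matrix: "transpose (gram_matrix u) = gram_matrix u"
  by (simp add: transpose_def gram_matrix_def vec_eq_iff inner_commute)

lemma gram_matrix_mult_nth: "(gram_matrix u *v c) $ i = u i \<bullet> (\<Sum>j\<in>UNIV. c $ j *\<^sub>R u j)"
  by (simp add: matrix_vector_mult_def gram_matrix_def inner_sum_right mult.commute)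

lemma inner_gram_matrix:
  "b \<bullet> (gram_matrix u *v c) = (\<Sum>i\<in>UNIV. b $ i *\<^sub>R u i) \<bullet> (\<Sum>j\<in>UNIV. c $ j *\<^sub>R u j)"
  unfolding inner_vec_def[of b] gram_matrix_mult_nth by (simp add: inner_sum_left)

text \<open>Injectivity lets a combination over the index type be rewritten, via
  \<open>inv u\<close>, as one over the set \<open>range u\<close>, to which
  \<open>independent\<close> applies.\<close>

lemma sum_scaleR_eq_0_independent:
  fixes u :: "'p::finite \<Rightarrow> 'a::real_vector"
  assumes "inj u" "independent (range u)" "(\<Sum>i\<in>UNIV. c $ i *\<^sub>R u i) = 0"
  shows "c = 0"
proof -
  have "(\<Sum>x\<in>range u. (c $ inv u x) *\<^sub>R x) = 0"
    using assms(1,3) by (simp add: sum.reindex)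
  then have "c $ inv u x = 0" if "x \<in> range u" for x
    using independentD[OF assms(2), of "range u" "\<lambda>x. c $ inv u x"] that by simp
  then show ?thesis
    using assms(1) by (metis inv_f_f rangeI vec_eq_iff zero_index)
qed

text \<open>A kernel vector \<open>c\<close> has form value zero, which is the squared norm of the
  combination of the \<open>u i\<close> with coefficients \<open>c\<close>; independence then forces
  \<open>c = 0\<close>.\<close>

lemma invertible_gram_matrix:
  fixes u :: "'p::finite \<Rightarrow> 'a::real_inner"
  assumes "inj u" "independent (range u)"
  shows "invertible (gram_matrix u)"
proof -
  have "c = 0" if "gram_matrix u *v c = 0" for c
    using that inner_gram_matrix[of c u c] sum_scaleR_eq_0_independent[OF assms] by simp
  then show ?thesis
    by (simp add: invertible_left_inverse matrix_left_invertible_ker)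
qed

lemma inner_vec_one_squared_le:
  fixes v :: "real^'p"
  shows "(vec 1 \<bullet> v)\<^sup>2 \<le> real CARD('p) * (v \<bullet> v)"
proof -
  have "vec 1 \<bullet> (vec 1 :: real^'p) = real CARD('p)" by (simp add: inner_vec_def)
  then show ?thesis using Cauchy_Schwarz_ineq[of "vec 1" v] by simp
qed

text \<open>Triangle inequality for unit vectors, then Cauchy--Schwarz on the absolute values of the
  coefficients. This is the source of the final bound \<open>1\<close>.\<close>

lemma gram_matrix_form_le:
  fixes u :: "'p::finite \<Rightarrow> 'a::real_inner"
  assumes "\<And>i. norm (u i) = 1"
  shows "v \<bullet> (gram_matrix u *v v) \<le> real CARD('p) * (v \<bullet> v)"
proof -
  define a :: "real^'p" where "a = (\<chi> i. \<bar>v $ i\<bar>)"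
  have "norm (\<Sum>i\<in>UNIV. v $ i *\<^sub>R u i) \<le> vec 1 \<bullet> a"
    using norm_sum[of "\<lambda>i. v $ i *\<^sub>R u i" UNIV] assms by (simp add: a_def inner_vec_def)
  then have "(norm (\<Sum>i\<in>UNIV. v $ i *\<^sub>R u i))\<^sup>2 \<le> (vec 1 \<bullet> a)\<^sup>2"
    by (intro power_mono) auto
  also have "\<dots> \<le> real CARD('p) * (a \<bullet> a)" by (rule inner_vec_one_squared_le)
  also have "a \<bullet> a = v \<bullet> v" by (simp add: a_def inner_vec_def)
  finally show ?thesis by (simp add: inner_gram_matrix power2_norm_eq_inner)
qed

lemma gram_matrix_eigenvalue_bounds:
  fixes u :: "'p::finite \<Rightarrow> 'a::real_inner"
  assumes "\<And>i. norm (u i) = 1" "k \<in> eigenvalues (gram_matrix u)"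
  shows "0 \<le> k" "k \<le> real CARD('p)"
proof -
  obtain v where v: "v \<noteq> 0" "gram_matrix u *v v = k *\<^sub>R v"
    using assms(2) by (auto simp: eigenvalues_def)
  then have pos: "v \<bullet> v > 0" by simp
  have "0 \<le> k * (v \<bullet> v)"
    using inner_gram_matrix[of v u v] v(2) by (metis inner_ge_zero inner_scaleR_right)
  then show "0 \<le> k" using pos by (simp add: zero_le_mult_iff)
  have "k * (v \<bullet> v) \<le> real CARD('p) * (v \<bullet> v)"
    using gram_matrix_form_le[of u v] assms(1) v(2) by simp
  then show "k \<le> real CARD('p)" using pos by simp
qed

section \<open>Projection of the origin onto an affine hull\<close>

text \<open>The hull lies in the affine set where \<open>x \<bullet> y = x \<bullet> x\<close>.
  There \<open>y - x\<close> is orthogonal to \<open>x\<close>, and Pythagoras gives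
  minimality.\<close>

lemma closest_point_affine_hull_0:
  fixes x :: "'a::euclidean_space"
  assumes x: "x \<in> affine hull S" and inner: "\<And>y. y \<in> S \<Longrightarrow> x \<bullet> y = x \<bullet> x"
  shows "closest_point (affine hull S) 0 = x"
proof -
  have "affine {y. x \<bullet> y = x \<bullet> x}" by (rule affine_hyperplane)
  then have eq: "x \<bullet> y = x \<bullet> x" if "y \<in> affine hull S" for y
    using hull_minimal[of S "{y. x \<bullet> y = x \<bullet> x}" affine] inner that by blast
  have "norm x \<le> norm y" if "y \<in> affine hull S" for y
  proof -
    have "(norm y)\<^sup>2 = (norm x)\<^sup>2 + (norm (y - x))\<^sup>2"
      using eq[OF that] by (simp add: power2_norm_eq_inner inner_diff inner_commute)
    then show ?thesis by (simp add: power2_le_imp_le)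
  qed
  then show ?thesis
    by (intro closest_point_unique[symmetric])
      (auto simp: x affine_imp_convex)
qed

lemma sum_scaleR_in_affine_hull_range:
  fixes u :: "'p::finite \<Rightarrow> 'a::real_vector"
  assumes "inj u" "vec 1 \<bullet> c = 1"
  shows "(\<Sum>i\<in>UNIV. c $ i *\<^sub>R u i) \<in> affine hull (range u)"
proof -
  have "(\<Sum>x\<in>range u. c $ inv u x) = 1" "(\<Sum>x\<in>range u. (c $ inv u x) *\<^sub>R x) = (\<Sum>i\<in>UNIV. c $ i *\<^sub>R u i)"
    using assms by (simp_all add: sum.reindex inner_vec_def)
  then show ?thesis by (auto simp: affine_hull_finite)
qed

theorem proposition4p1:
  fixes K :: "(real^'n) set"
    and u :: "'p::finite \<Rightarrow> real^'n"
    and d :: "real^'n"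
    and M :: "real^'p^'p"
  assumes "polyhedron K" and "convex_cone K"
    and "bij_betw u UNIV (normalized_conic_base K)"
    and "K = convex_cone hull (normalized_conic_base K)"
    and "independent (normalized_conic_base K)"
    and "d = circumcentric_direction K"
    and "M = gram_matrix u"
  shows "d = - ((1 / (vec 1 \<bullet> (matrix_inv M *v vec 1))) *\<^sub>R
                  (\<Sum>i\<in>UNIV. (matrix_inv M *v vec 1) $ i *\<^sub>R u i)) \<and>
         (norm d)\<^sup>2 = 1 / (vec 1 \<bullet> (matrix_inv M *v vec 1)) \<and>
         lambda_min M / real CARD('p) \<le> (norm d)\<^sup>2 \<and>
         (norm d)\<^sup>2 \<le> lambda_max M / real CARD('p) \<and>
         lambda_max M / real CARD('p) \<le> 1"
proof -
  have inj: "inj u" and base: "normalized_conic_base K = range u"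
    using assms(3) by (auto simp: bij_betw_def)
  have ind: "independent (range u)" using assms(5) base by simp
  have unit: "norm (u i) = 1" for i
    using base by (auto simp: normalized_conic_base_def)
  have sym: "transpose M = M" by (simp add: assms(7) transpose_gram_matrix)
  define G where "G c = (\<Sum>i\<in>UNIV. c $ i *\<^sub>R u i)" for c :: "real^'p"
  have G_scale: "G (t *\<^sub>R c) = t *\<^sub>R G c" for t c
    by (simp add: G_def scaleR_sum_right)
  have form: "b \<bullet> (M *v c) = G b \<bullet> G c" for b c
    by (simp add: assms(7) G_def inner_gram_matrix)
  have G_hull: "G c \<in> affine hull (range u)" if "vec 1 \<bullet> c = 1" for c
    unfolding G_def using inj that by (rule sum_scaleR_in_affine_hull_range)
  define p where "p = real CARD('p)"
  have p: "p > 0" by (simp add: p_def)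
  have one_one: "vec 1 \<bullet> (vec 1 :: real^'p) = p" by (simp add: p_def inner_vec_def)
  define w where "w = matrix_inv M *v vec 1"
  define s where "s = vec 1 \<bullet> w"
  \<comment> \<open>\<open>matrix_inv\<close> is a choice operator, so its defining property has to
    be drawn from invertibility.\<close>
  have "M ** matrix_inv M = mat 1"
    using someI_ex[OF invertible_gram_matrix[OF inj ind, unfolded invertible_def]]
    by (simp add: assms(7) matrix_inv_def)
  then have Mw: "M *v w = vec 1"
    by (simp add: w_def matrix_vector_mul_assoc)
  have inner_Gw: "u i \<bullet> G w = 1" for i
    using gram_matrix_mult_nth[of u w i] Mw by (simp add: assms(7) G_def)
  have s_eq: "s = G w \<bullet> G w"
    using form[of w w] Mw by (simp add: s_def inner_commute)
  have "G w \<noteq> 0" using inner_Gw by force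
  then have s: "s > 0" by (simp add: s_eq)
  \<comment> \<open>Dividing by \<open>s\<close> makes the coefficients sum to one, which puts
    \<open>G c\<close> in the affine hull.\<close>
  define c where "c = (1 / s) *\<^sub>R w"
  have c: "vec 1 \<bullet> c = 1" using s s_def by (simp add: c_def)
  have norm_Gc: "G c \<bullet> G c = 1 / s"
    using s by (simp add: c_def G_scale flip: s_eq)
  have proj: "closest_point (affine hull (range u)) 0 = G c"
  proof (rule closest_point_affine_hull_0[OF G_hull[OF c]])
    fix y assume "y \<in> range u"
    then show "G c \<bullet> y = G c \<bullet> G c"
      using inner_Gw by (auto simp: norm_Gc) (auto simp: c_def G_scale inner_commute)
  qed
  have d: "d = - G c"
    using assms(6) base proj by (simp add: circumcentric_direction_def)
  have norm_d: "(norm d)\<^sup>2 = 1 / s"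
    by (simp add: d power2_norm_eq_inner norm_Gc)
  have lower: "lambda_min M / p \<le> (norm d)\<^sup>2"
  proof -
    \<comment> \<open>The sign matters because \<open>1 / p \<le> c \<bullet> c\<close> is about to
      be multiplied by \<open>lambda_min M\<close>.\<close>
    have nonneg: "0 \<le> lambda_min M"
      using gram_matrix_eigenvalue_bounds(1)[of u, OF unit] lambda_min_in_eigenvalues[OF sym] assms(7)
      by blast
    have "1 / p \<le> c \<bullet> c"
      using inner_vec_one_squared_le[of c] c p by (simp add: p_def field_simps)
    then have "lambda_min M * (1 / p) \<le> lambda_min M * (c \<bullet> c)"
      using nonneg by (rule mult_left_mono)
    also have "\<dots> \<le> (norm d)\<^sup>2"
      using lambda_min_le_rayleigh[OF sym, of c] by (simp add: form norm_Gc norm_d)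
    finally show ?thesis by simp
  qed
  have upper: "(norm d)\<^sup>2 \<le> lambda_max M / p"
  proof -
    \<comment> \<open>The barycentre \<open>G b\<close> lies in the hull, so it is no closer to the
      origin than \<open>G c\<close>, and \<open>b \<bullet> b = 1 / p\<close> supplies the factor
      in the Rayleigh bound.\<close>
    define b :: "real^'p" where "b = (1 / p) *\<^sub>R vec 1"
    have b: "vec 1 \<bullet> b = 1" "b \<bullet> b = 1 / p" using p one_one by (simp_all add: b_def)
    have "dist 0 (G c) \<le> dist 0 (G b)"
      using closest_point_le[OF closed_affine_hull G_hull[OF b(1)], of 0] by (simp add: proj)
    then have "(norm d)\<^sup>2 \<le> G b \<bullet> G b"
      by (simp add: d flip: power2_norm_eq_inner)
    also have "\<dots> \<le> lambda_max M / p"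
      using rayleigh_le_lambda_max[OF sym, of b] by (simp add: form b)
    finally show ?thesis .
  qed
  have "lambda_max M / p \<le> 1"
    using gram_matrix_eigenvalue_bounds(2)[of u, OF unit] lambda_max_in_eigenvalues[OF sym] assms(7) p
    by (simp add: p_def)
  moreover have "d = - ((1 / s) *\<^sub>R G w)" by (simp add: d c_def G_scale)
  ultimately show ?thesis
    using norm_d lower upper unfolding s_def G_def w_def p_def by blast
qed

end
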